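(* Let $k \geq 2$ and let $(\mathcal{H}_n)_{n \in \mathbb{N}}$ be a sequence of $k$-uniform hypergraphs with $v(\mathcal{H}_n) \to \infty$ such that there exists $\epsilon > 0$ so that for every $2 \leq \ell \leq k-1$, $$\Delta_\ell(\mathcal{H}_n)^{\frac{1}{k-\ell}} \, v(\mathcal{H}_n)^{\epsilon} = O\left( \Delta_1(\mathcal{H}_n)^{\frac{1}{k-1}} \right).$$ Then the threshold biases satisfy $q(\mathcal{H}_n) = O\left( \Delta_1(\mathcal{H}_n)^{\frac{1}{k-1}} \right)$.
   Context: For a hypergraph $\mathcal{H}$, $v(\mathcal{H})$ is the number of vertices. For $S \subseteq V(\mathcal{H})$, $\deg(S)$ is the number of edges containing $S$, and $\Delta_\ell(\mathcal{H}) = \max\{\deg(S) : S \subseteq V(\mathcal{H}), |S| = \ell\}$. For a positive integer $q$, the $q$-biased Maker-Breaker game $\mathbf{G}(\mathcal{H};q)$: Maker and Breaker alternately occupy previously unoccupied vertices of $\mathcal{H}$, Maker first, Maker occupying one vertex per round and Breaker up to $q$ vertices per round; Maker wins if his vertices fully contain some edge of $\mathcal{H}$, Breaker wins otherwise. The threshold bias $q(\mathcal{H})$ is the smallest positive integer $q$ for which Breaker has a winning strategy in $\mathbf{G}(\mathcal{H};q)$.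
   Formalization: The formal theorem also assumes that the hypergraphs have at least one edge for all sufficiently large n; for edgeless hypergraphs the maximum degree is 0 while the threshold bias is 1, so the stated bound fails. *)

theory Defs
  imports Complex_Main "HOL-Library.Landau_Symbols"
begin

type_synonym 'a hypergraph = "'a set \<times> 'a set set"

abbreviation verts :: "'a hypergraph \<Rightarrow> 'a set" where
  "verts H \<equiv> fst H"

abbreviation edges :: "'a hypergraph \<Rightarrow> 'a set set" where
  "edges H \<equiv> snd H"

definition uniform_hypergraph :: "nat \<Rightarrow> 'a hypergraph \<Rightarrow> bool" where
  "uniform_hypergraph k H \<longleftrightarrow>
     finite (verts H) \<and> (\<forall>e\<in>edges H. e \<subseteq> verts H \<and> card e = k)"

definition deg :: "'a hypergraph \<Rightarrow> 'a set \<Rightarrow> nat" where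
  "deg H S = card {e \<in> edges H. S \<subseteq> e}"

definition max_deg :: "nat \<Rightarrow> 'a hypergraph \<Rightarrow> nat" where
  "max_deg l H = Max {deg H S |S. S \<subseteq> verts H \<and> card S = l}"

text \<open>
  A history lists the completed rounds of the game; the round \<open>(x, B)\<close> records the vertex
  \<open>x\<close> occupied by Maker and the set \<open>B\<close> of vertices with which Breaker answered.
\<close>

type_synonym 'a history = "('a \<times> 'a set) list"

definition maker_set :: "'a history \<Rightarrow> 'a set" where
  "maker_set h = fst ` set h"

definition breaker_set :: "'a history \<Rightarrow> 'a set" where
  "breaker_set h = \<Union> (snd ` set h)"

definition free_verts :: "'a hypergraph \<Rightarrow> 'a history \<Rightarrow> 'a set" where
  "free_verts H h = verts H - (maker_set h \<union> breaker_set h)"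

text \<open>
  A Breaker strategy maps the history and Maker's current vertex to the set Breaker occupies.
  The following are the histories that can arise when Breaker plays by \<open>\<sigma>\<close>; Maker must occupy
  a vertex as long as there is a free one.
\<close>

inductive arises :: "'a hypergraph \<Rightarrow> ('a history \<Rightarrow> 'a \<Rightarrow> 'a set) \<Rightarrow> 'a history \<Rightarrow> bool"
  for H \<sigma> where
  start: "arises H \<sigma> []"
| round: "arises H \<sigma> h \<Longrightarrow> x \<in> free_verts H h \<Longrightarrow> arises H \<sigma> (h @ [(x, \<sigma> h x)])"

definition breaker_strategy ::
    "'a hypergraph \<Rightarrow> nat \<Rightarrow> ('a history \<Rightarrow> 'a \<Rightarrow> 'a set) \<Rightarrow> bool" where
  "breaker_strategy H q \<sigma> \<longleftrightarrow>
     (\<forall>h x. arises H \<sigma> h \<and> x \<in> free_verts H h \<longrightarrow>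
        \<sigma> h x \<subseteq> free_verts H h - {x} \<and> card (\<sigma> h x) \<le> q)"

definition maker_wins_play :: "'a hypergraph \<Rightarrow> 'a history \<Rightarrow> bool" where
  "maker_wins_play H h \<longleftrightarrow> (\<exists>e\<in>edges H. e \<subseteq> maker_set h)"

text \<open>The game ends when every vertex is occupied.\<close>

definition breaker_wins :: "'a hypergraph \<Rightarrow> nat \<Rightarrow> bool" where
  "breaker_wins H q \<longleftrightarrow>
     (\<exists>\<sigma>. breaker_strategy H q \<sigma> \<and>
        (\<forall>h. arises H \<sigma> h \<and> free_verts H h = {} \<longrightarrow> \<not> maker_wins_play H h))"

definition threshold_bias :: "'a hypergraph \<Rightarrow> nat" where
  "threshold_bias H = (LEAST q. 0 < q \<and> breaker_wins H q)"

end

theory Submission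
  imports Defs
begin

text \<open>
  When Maker takes a vertex \<open>x\<close>, Breaker must at once take every free vertex \<open>v\<close> that would
  complete an edge through \<open>x\<close>; so it suffices that the number \<open>Z\<close> of such threats never exceeds
  \<open>O(\<beta>)\<close>, where \<open>\<beta>\<close> is the \<open>(k - 1)\<close>-st root of the maximum degree. To guarantee
  this, Breaker spends another \<open>b \<approx> \<beta>\<close> vertices per round on Beck's potential strategy, which
  bounds the number of sets of a family that Maker ever occupies by
  \<open>(1 + b)\<close> times the sum of \<open>(1 + b)\<close> to the power \<open>- |A|\<close> over the family. The family consists
  of the unions of \<open>r\<close> threats at a common vertex, counted as ordered \<open>r\<close>-tuples, so it
  bounds the \<open>r\<close>-th moment of \<open>Z\<close>. Adding one more threat to a tuple contributes a factor
  \<open>O(\<beta>)\<close> if it meets the previous ones only in \<open>x\<close>, and the codegree condition makes all other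
  intersection patterns negligible as long as \<open>r\<close> is polylogarithmic in the number \<open>N\<close> of
  vertices. With \<open>r \<approx> ln N\<close> the factor \<open>N\<close> for the choice of \<open>x\<close> is absorbed by the
  \<open>r\<close>-th root.
\<close>

section \<open>From strategies to invariants of positions\<close>

text \<open>Only the two occupied sets matter, so Breaker may answer with any set that restores
  \<open>P\<close>, picked by choice. \<open>P\<close> speaks of positions with Maker to move;
  \<open>final\<close> concerns full boards because the winner is decided there.\<close>

lemma breaker_wins_invariantI:
  assumes init: "P {} {}"
    and step: "\<And>M B x. P M B \<Longrightarrow> x \<in> verts H - (M \<union> B) \<Longrightarrow>
      \<exists>Y. Y \<subseteq> verts H - (M \<union> B) - {x} \<and> card Y \<le> q \<and> P (insert x M) (B \<union> Y)"
    and final: "\<And>M B e. P M B \<Longrightarrow> verts H \<subseteq> M \<union> B \<Longrightarrow> e \<in> edges H \<Longrightarrow> \<not> e \<subseteq> M"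
  shows "breaker_wins H q"
proof -
  define good where "good h x Y \<longleftrightarrow> Y \<subseteq> free_verts H h - {x} \<and> card Y \<le> q
      \<and> P (insert x (maker_set h)) (breaker_set h \<union> Y)" for h x Y
  define \<sigma> where "\<sigma> h x = (SOME Y. good h x Y)" for h x
  have good: "good h x (\<sigma> h x)"
    if "P (maker_set h) (breaker_set h)" "x \<in> free_verts H h" for h x
  proof -
    have "\<exists>Y. good h x Y"
      using step[OF that(1), of x] that(2) unfolding good_def free_verts_def by blast
    then show ?thesis unfolding \<sigma>_def by (rule someI_ex)
  qed
  have inv: "P (maker_set h) (breaker_set h)" if "arises H \<sigma> h" for h
    using that
  proof induction
    case start
    then show ?case using init by (simp add: maker_set_def breaker_set_def)
  next
    case (round h x)
    then have "P (insert x (maker_set h)) (breaker_set h \<union> \<sigma> h x)"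
      using good unfolding good_def by blast
    moreover have "maker_set (h @ [(x, \<sigma> h x)]) = insert x (maker_set h)"
      by (auto simp: maker_set_def)
    moreover have "breaker_set (h @ [(x, \<sigma> h x)]) = breaker_set h \<union> \<sigma> h x"
      by (auto simp: breaker_set_def)
    ultimately show ?case by simp
  qed
  have "breaker_strategy H q \<sigma>"
    unfolding breaker_strategy_def using good inv unfolding good_def by blast
  moreover have "\<not> maker_wins_play H h" if "arises H \<sigma> h" "free_verts H h = {}" for h
    using final[OF inv[OF that(1)]] that(2)
    unfolding maker_wins_play_def free_verts_def by blast
  ultimately show ?thesis unfolding breaker_wins_def by blast
qed

section \<open>Beck's potential strategy\<close>

text \<open>The Erdos-Selfridge weight, in Beck's form for bias \<open>b\<close>. Sets touched by
  Breaker are dead. The family is indexed so that a set counts once per index: many tuples of spokes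
  can have the same union.\<close>

definition potential ::
    "nat \<Rightarrow> 'i set \<Rightarrow> ('i \<Rightarrow> 'a set) \<Rightarrow> 'a set \<Rightarrow> 'a set \<Rightarrow> real" where
  "potential b I A M B =
     (\<Sum>i\<in>I. if A i \<inter> B = {} then (1 / (1 + real b)) ^ card (A i - M) else 0)"

lemma potential_antimono:
  "B \<subseteq> B' \<Longrightarrow> potential b I A M B' \<le> potential b I A M B"
  unfolding potential_def by (intro sum_mono) auto

text \<open>A live set through \<open>x\<close> has one missing vertex fewer, which multiplies its
  weight by \<open>1 + b\<close>; the increase is \<open>b\<close> times the old weight.\<close>

lemma potential_insert_maker:
  assumes "\<And>i. i \<in> I \<Longrightarrow> finite (A i)" "x \<notin> M"
  shows "potential b I A (insert x M) B = potential b I A M B + real b *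
    (\<Sum>i\<in>I. if A i \<inter> B = {} \<and> x \<in> A i then (1 / (1 + real b)) ^ card (A i - M) else 0)"
proof -
  let ?z = "1 / (1 + real b)"
  have "?z ^ card (A i - insert x M) = (1 + real b) * ?z ^ card (A i - M)"
    if "i \<in> I" "x \<in> A i" for i
  proof -
    have "A i - M = insert x (A i - insert x M)" using that assms(2) by auto
    then have "card (A i - M) = Suc (card (A i - insert x M))"
      using assms(1)[OF that(1)] by (metis Diff_iff card_insert_disjoint finite_Diff insertI1)
    then show ?thesis by simp
  qed
  moreover have "A i - insert x M = A i - M" if "x \<notin> A i" for i
    using that by auto
  ultimately show ?thesis
    unfolding potential_def sum_distrib_left sum.distrib[symmetric]
    by (intro sum.cong) (auto simp: algebra_simps)
qed

text \<open>A set that Maker owns completely is alive and has weight 1.\<close>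

lemma card_le_potential:
  assumes "finite I" "J \<subseteq> I" "\<And>i. i \<in> J \<Longrightarrow> A i \<subseteq> M" "M \<inter> B = {}"
  shows "real (card J) \<le> potential b I A M B"
proof -
  have eq: "A i - M = {}" "A i \<inter> B = {}" if "i \<in> J" for i
    using that assms(3,4) by blast+
  have "real (card J) = (\<Sum>i\<in>J. if A i \<inter> B = {} then (1 / (1 + real b)) ^ card (A i - M) else 0)"
    by (simp add: eq)
  also have "\<dots> \<le> potential b I A M B"
    unfolding potential_def by (intro sum_mono2 assms) auto
  finally show ?thesis .
qed

text \<open>Breaker removes as much potential as he can. Exchanging one of his vertices \<open>y\<close> for \<open>x\<close>
  shows that the sets still alive through \<open>x\<close> weigh at most as much as the sets
  killed by \<open>y\<close> alone.\<close>

lemma breaker_response: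
  assumes I: "finite I" and A: "\<And>i. i \<in> I \<Longrightarrow> finite (A i)" and W: "finite W" "W \<inter> M = {}"
  obtains Y where "Y \<subseteq> W" "card Y \<le> b"
    "\<And>x. x \<in> W - Y \<Longrightarrow> potential b I A (insert x M) (B \<union> Y) \<le> potential b I A M B"
proof (cases "card W \<le> b")
  case True
  then show ?thesis using that[of W] by auto
next
  case False
  define S where "S = {Y. Y \<subseteq> W \<and> card Y = b}"
  have "finite S" unfolding S_def using W(1) by simp
  moreover have "S \<noteq> {}"
    using obtain_subset_with_card_n[of b W] False unfolding S_def by force
  ultimately obtain Y where Y: "Y \<in> S"
    and min: "\<And>Y'. Y' \<in> S \<Longrightarrow> potential b I A M (B \<union> Y) \<le> potential b I A M (B \<union> Y')"
    using ex_is_arg_min_if_finite[of S "\<lambda>Y. potential b I A M (B \<union> Y)"]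
    unfolding is_arg_min_linorder by blast
  have YW: "Y \<subseteq> W" "card Y = b" "finite Y"
    using Y W(1) unfolding S_def by (auto intro: finite_subset)
  define w where "w i = (1 / (1 + real b)) ^ card (A i - M)" for i
  have w0: "w i \<ge> 0" for i unfolding w_def by simp
  have "potential b I A (insert x M) (B \<union> Y) \<le> potential b I A M B" if x: "x \<in> W - Y" for x
  proof -
    \<comment> \<open>By \<open>potential_insert_maker\<close>, Maker's taking \<open>x\<close>
      after the response \<open>Y\<close> adds \<open>b * g\<close>. It remains to show that
      \<open>Y\<close> has removed at least as much.\<close>
    define g where "g = (\<Sum>i\<in>I. if A i \<inter> (B \<union> Y) = {} \<and> x \<in> A i then w i else 0)"
    define killed where
      "killed y = (\<Sum>i\<in>I. if A i \<inter> B = {} \<and> A i \<inter> Y = {y} then w i else 0)" for y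
    have g_le: "g \<le> killed y" if y: "y \<in> Y" for y
    proof -
      have "card (insert x (Y - {y})) = b"
        using x y YW by (metis DiffE card.remove card_insert_disjoint finite_Diff)
      then have "insert x (Y - {y}) \<in> S"
        unfolding S_def using x YW by auto
      then have "potential b I A M (B \<union> Y) \<le> potential b I A M (B \<union> insert x (Y - {y}))"
        by (rule min)
      \<comment> \<open>Compared set by set: a set through \<open>x\<close> that avoids
        \<open>Y\<close> is dead after the exchange, and a set alive after the exchange meets
        \<open>Y\<close> at most in \<open>y\<close>.\<close>
      moreover have "potential b I A M (B \<union> insert x (Y - {y})) + g
          \<le> potential b I A M (B \<union> Y) + killed y"
        unfolding potential_def g_def killed_def sum.distrib[symmetric] w_def[symmetric]
      proof (intro sum_mono)
        fix i
        have "A i \<inter> Y = {} \<or> A i \<inter> Y = {y}" if "A i \<inter> (B \<union> insert x (Y - {y})) = {}"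
          using that by blast
        then show "(if A i \<inter> (B \<union> insert x (Y - {y})) = {} then w i else 0) +
            (if A i \<inter> (B \<union> Y) = {} \<and> x \<in> A i then w i else 0)
          \<le> (if A i \<inter> (B \<union> Y) = {} then w i else 0) +
            (if A i \<inter> B = {} \<and> A i \<inter> Y = {y} then w i else 0)"
          using w0[of i] by (auto simp: Int_Un_distrib)
      qed
      ultimately show ?thesis by linarith
    qed
    \<comment> \<open>No set is killed alone by two different \<open>y\<close>, so the
      \<open>b\<close> bounds add up to at most the weight removed by \<open>Y\<close>.\<close>
    have "real b * g = (\<Sum>y\<in>Y. g)" using YW by simp
    also have "\<dots> \<le> (\<Sum>y\<in>Y. killed y)" by (intro sum_mono g_le)
    also have "\<dots> = (\<Sum>i\<in>I. \<Sum>y\<in>Y. if A i \<inter> B = {} \<and> A i \<inter> Y = {y} then w i else 0)"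
      unfolding killed_def by (rule sum.swap)
    also have "\<dots> \<le> (\<Sum>i\<in>I. if A i \<inter> B = {} \<and> A i \<inter> Y \<noteq> {} then w i else 0)"
    proof (intro sum_mono)
      fix i
      show "(\<Sum>y\<in>Y. if A i \<inter> B = {} \<and> A i \<inter> Y = {y} then w i else 0)
        \<le> (if A i \<inter> B = {} \<and> A i \<inter> Y \<noteq> {} then w i else 0)"
      proof (cases "A i \<inter> B = {} \<and> (\<exists>y. A i \<inter> Y = {y})")
        case True
        then obtain y where y: "A i \<inter> Y = {y}" "y \<in> Y" by blast
        have "(\<Sum>y'\<in>Y. if A i \<inter> B = {} \<and> A i \<inter> Y = {y'} then w i else 0)
            = (\<Sum>y'\<in>Y. if y' = y then w i else 0)"
          using True y by (intro sum.cong) auto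
        then show ?thesis using y YW(3) True by simp
      next
        case False
        then have "(\<Sum>y\<in>Y. if A i \<inter> B = {} \<and> A i \<inter> Y = {y} then w i else 0) = 0"
          by (intro sum.neutral) auto
        then show ?thesis using w0[of i] by auto
      qed
    qed
    also have "\<dots> = potential b I A M B - potential b I A M (B \<union> Y)"
      unfolding potential_def sum_subtractf[symmetric] w_def
      by (intro sum.cong) (auto simp: Int_Un_distrib)
    finally have "real b * g \<le> potential b I A M B - potential b I A M (B \<union> Y)" .
    moreover have "x \<notin> M" using x W(2) by blast
    ultimately show ?thesis
      using potential_insert_maker[of I A x M b "B \<union> Y"] A unfolding g_def w_def by auto
  qed
  then show ?thesis using that[of Y] YW by simp
qed

section \<open>Degrees, spokes and the weight of fans\<close>

lemma finite_edges: "uniform_hypergraph k H \<Longrightarrow> finite (edges H)"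
  unfolding uniform_hypergraph_def by (rule finite_subset[of _ "Pow (verts H)"]) auto

lemma deg_le_max_deg:
  assumes "uniform_hypergraph k H"
  shows "deg H L \<le> max_deg (card L) H"
proof (cases "L \<subseteq> verts H")
  case True
  have "finite {deg H S |S. S \<subseteq> verts H \<and> card S = card L}"
    using assms unfolding uniform_hypergraph_def by simp
  then show ?thesis unfolding max_deg_def using True by (intro Max_ge) auto
next
  case False
  then have "{e \<in> edges H. L \<subseteq> e} = {}"
    using assms unfolding uniform_hypergraph_def by blast
  then show ?thesis unfolding deg_def by (metis card.empty le0)
qed

text \<open>A spoke \<open>(e, v)\<close> at \<open>x\<close> becomes a threat once Maker owns its core \<open>e - {v}\<close>.\<close>

definition spokes :: "'a hypergraph \<Rightarrow> 'a \<Rightarrow> ('a set \<times> 'a) set" where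
  "spokes H x = {(e, v). e \<in> edges H \<and> x \<in> e \<and> v \<in> e \<and> v \<noteq> x}"

definition core :: "'a set \<times> 'a \<Rightarrow> 'a set" where
  "core p = fst p - {snd p}"

text \<open>Every core of a spoke at \<open>x\<close> contains \<open>x\<close> already; inserting
  it gives the empty tuple the fan \<open>{x}\<close>, so that the induction over tuples starts with
  weight \<open>z\<close>.\<close>

definition fan :: "'a \<Rightarrow> ('a set \<times> 'a) list \<Rightarrow> 'a set" where
  "fan x ps = insert x (\<Union>p\<in>set ps. core p)"

lemma
  assumes "uniform_hypergraph k H"
  shows finite_spokes: "finite (spokes H x)"
    and finite_core: "p \<in> spokes H x \<Longrightarrow> finite (core p)"
    and card_core: "p \<in> spokes H x \<Longrightarrow> card (core p) = k - 1"
proof -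
  have fin: "finite e" if "e \<in> edges H" for e
    using assms that unfolding uniform_hypergraph_def by (meson finite_subset)
  have "spokes H x \<subseteq> Sigma (edges H) (\<lambda>e. e)"
    unfolding spokes_def by auto
  then show "finite (spokes H x)"
    using finite_edges[OF assms] fin by (meson finite_SigmaI finite_subset)
  show "p \<in> spokes H x \<Longrightarrow> finite (core p)"
    using fin unfolding spokes_def core_def by auto
  show "p \<in> spokes H x \<Longrightarrow> card (core p) = k - 1"
    using assms fin unfolding spokes_def core_def uniform_hypergraph_def by auto
qed

text \<open>Group the spokes by \<open>L = core p \<inter> U\<close>. Each edge containing
  \<open>L\<close> gives at most \<open>k\<close> spokes, each with \<open>k - 1 - card L\<close>
  vertices outside \<open>U\<close>. Since \<open>x\<close> lies in \<open>L\<close>, the only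
  \<open>L\<close> of size 1 is \<open>{x}\<close>; for larger sizes \<open>l\<close> there are at
  most \<open>m ^ l\<close> choices.\<close>

lemma sum_spokes_le:
  fixes z :: real
  assumes H: "uniform_hypergraph k H" and k: "k \<ge> 2" and z: "z \<ge> 0"
    and U: "finite U" "x \<in> U" "card U \<le> m"
  shows "(\<Sum>p\<in>spokes H x. z ^ card (core p - U))
    \<le> real k * real (max_deg 1 H) * z ^ (k - 2)
      + (\<Sum>l\<in>{2..k-1}. real m ^ l * (real k * real (max_deg l H) * z ^ (k - 1 - l)))"
proof -
  let ?f = "\<lambda>l. real k * real (max_deg l H) * z ^ (k - 1 - l)"
  define Ls where "Ls = {L. L \<subseteq> U \<and> x \<in> L \<and> card L \<in> {1..k-1}}"
  have "Ls \<subseteq> Pow U" unfolding Ls_def by auto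
  then have finLs: "finite Ls" using U(1) finite_subset by blast
  have img: "(\<lambda>p. core p \<inter> U) ` spokes H x \<subseteq> Ls"
  proof (intro image_subsetI)
    fix p assume p: "p \<in> spokes H x"
    have x: "x \<in> core p \<inter> U" using p U(2) unfolding spokes_def core_def by auto
    have "card (core p \<inter> U) \<le> k - 1"
      using card_mono[OF finite_core[OF H p], of "core p \<inter> U"] card_core[OF H p] by auto
    moreover have "card (core p \<inter> U) > 0"
      using x U(1) by (auto simp: card_gt_0_iff)
    ultimately show "core p \<inter> U \<in> Ls" unfolding Ls_def using x by auto
  qed
  have group: "(\<Sum>p\<in>{p \<in> spokes H x. core p \<inter> U = L}. z ^ card (core p - U)) \<le> ?f (card L)" for L
  proof -
    let ?G = "{p \<in> spokes H x. core p \<inter> U = L}"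
    have fin: "finite e" if "e \<in> edges H" for e
      using H that unfolding uniform_hypergraph_def by (meson finite_subset)
    have "?G \<subseteq> Sigma {e \<in> edges H. L \<subseteq> e} (\<lambda>e. e)"
      unfolding spokes_def core_def by auto
    then have "card ?G \<le> card (Sigma {e \<in> edges H. L \<subseteq> e} (\<lambda>e. e))"
      using finite_edges[OF H] fin by (intro card_mono) auto
    also have "\<dots> = (\<Sum>e\<in>{e \<in> edges H. L \<subseteq> e}. card e)"
      using finite_edges[OF H] fin by (intro card_SigmaI) auto
    also have "\<dots> = k * deg H L"
      unfolding deg_def using H unfolding uniform_hypergraph_def by simp
    also have "\<dots> \<le> k * max_deg (card L) H"
      using deg_le_max_deg[OF H] by simp
    finally have "real (card ?G) \<le> real k * real (max_deg (card L) H)"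
      unfolding of_nat_mult[symmetric] of_nat_le_iff .
    then have "real (card ?G) * z ^ (k - 1 - card L) \<le> ?f (card L)"
      using z by (intro mult_right_mono) auto
    moreover have "card (core p - U) = k - 1 - card L" if "p \<in> ?G" for p
    proof -
      have "p \<in> spokes H x" "core p \<inter> U = L" using that by auto
      then show ?thesis
        using card_Diff_subset_Int[of "core p" U] finite_core[OF H, of p x] card_core[OF H, of p x]
        by (metis finite_Int)
    qed
    ultimately show ?thesis by simp
  qed
  have "(\<Sum>p\<in>spokes H x. z ^ card (core p - U))
      = (\<Sum>L\<in>Ls. \<Sum>p\<in>{p \<in> spokes H x. core p \<inter> U = L}. z ^ card (core p - U))"
    by (rule sum.group[OF finite_spokes[OF H] finLs img, symmetric])
  also have "\<dots> \<le> (\<Sum>L\<in>Ls. ?f (card L))"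
    by (intro sum_mono group)
  also have "\<dots> = (\<Sum>l\<in>{1..k-1}. \<Sum>L\<in>{L \<in> Ls. card L = l}. ?f (card L))"
    by (rule sum.group[OF finLs, symmetric]) (auto simp: Ls_def)
  also have "\<dots> = (\<Sum>l\<in>{1..k-1}. real (card {L \<in> Ls. card L = l}) * ?f l)"
    by (intro sum.cong) auto
  also have "\<dots> = real (card {L \<in> Ls. card L = 1}) * ?f 1
      + (\<Sum>l\<in>{2..k-1}. real (card {L \<in> Ls. card L = l}) * ?f l)"
    using k by (simp add: sum.atLeast_Suc_atMost numeral_2_eq_2)
  also have "\<dots> \<le> 1 * ?f 1 + (\<Sum>l\<in>{2..k-1}. real m ^ l * ?f l)"
  proof (intro add_mono sum_mono mult_right_mono)
    have "{L \<in> Ls. card L = 1} \<subseteq> {{x}}"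
      unfolding Ls_def by (auto simp: card_1_singleton_iff)
    then have "card {L \<in> Ls. card L = 1} \<le> 1"
      using card_mono[of "{{x}}"] by fastforce
    then show "real (card {L \<in> Ls. card L = 1}) \<le> 1" by simp
  next
    fix l
    have "card {L \<in> Ls. card L = l} \<le> card {L. L \<subseteq> U \<and> card L = l}"
      unfolding Ls_def using U(1) by (intro card_mono) auto
    also have "\<dots> = card U choose l" using n_subsets[OF U(1)] by simp
    also have "\<dots> \<le> card U ^ l"
      by (cases "l \<le> card U") (auto intro: binomial_le_pow simp: binomial_eq_0)
    also have "\<dots> \<le> m ^ l" using U(3) by (rule power_mono) simp
    finally show "real (card {L \<in> Ls. card L = l}) \<le> real m ^ l"
      unfolding of_nat_power[symmetric] of_nat_le_iff .
  qed (use z in auto)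
  finally show ?thesis by (simp add: numeral_2_eq_2)
qed

text \<open>Induction on the tuple: a further spoke contributes only its vertices outside the
  current fan, with total weight at most \<open>F\<close> by \<open>sum_spokes_le\<close>. The size
  \<open>1 + r * k\<close> in \<open>F\<close> covers every fan with at most \<open>r\<close>
  spokes.\<close>

lemma sum_fans_le:
  fixes z F :: real
  assumes H: "uniform_hypergraph k H" and k: "k \<ge> 2" and z: "z \<ge> 0"
    and F: "real k * real (max_deg 1 H) * z ^ (k - 2)
      + (\<Sum>l\<in>{2..k-1}. real (1 + r * k) ^ l * (real k * real (max_deg l H) * z ^ (k - 1 - l))) \<le> F"
    and n: "n \<le> r"
  shows "(\<Sum>ps | set ps \<subseteq> spokes H x \<and> length ps = n. z ^ card (fan x ps)) \<le> z * F ^ n"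
  using n
proof (induction n)
  case 0
  have "{ps. set ps \<subseteq> spokes H x \<and> length ps = 0} = {[]}" by auto
  then show ?case by (simp add: fan_def)
next
  case (Suc n)
  let ?T = "\<lambda>n. {ps. set ps \<subseteq> spokes H x \<and> length ps = n}"
  have fin: "finite (fan x ps)" and card: "card (fan x ps) \<le> 1 + length ps * k"
    if "set ps \<subseteq> spokes H x" for ps
  proof -
    show "finite (fan x ps)"
      unfolding fan_def using that finite_core[OF H] by auto
    show "card (fan x ps) \<le> 1 + length ps * k"
      using that
    proof (induction ps)
      case (Cons p ps)
      have "fan x (p # ps) = fan x ps \<union> core p" unfolding fan_def by auto
      then have "card (fan x (p # ps)) \<le> card (fan x ps) + card (core p)"
        by (metis card_Un_le)
      then show ?case using Cons card_core[OF H, of p x] by auto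
    qed (simp add: fan_def)
  qed
  have F0: "F \<ge> 0"
    by (rule order_trans[OF _ F]) (use z in \<open>auto intro!: add_nonneg_nonneg sum_nonneg\<close>)
  have "(\<Sum>ps\<in>?T (Suc n). z ^ card (fan x ps))
      = (\<Sum>(ps, p)\<in>?T n \<times> spokes H x. z ^ card (fan x (p # ps)))"
    by (rule sum.reindex_bij_witness[of _ "\<lambda>(ps, p). p # ps" "\<lambda>ps. (tl ps, hd ps)"])
      (auto simp: length_Suc_conv)
  also have "\<dots> = (\<Sum>ps\<in>?T n. \<Sum>p\<in>spokes H x. z ^ card (fan x (p # ps)))"
    by (rule sum.cartesian_product[symmetric])
  also have "\<dots> = (\<Sum>ps\<in>?T n. z ^ card (fan x ps) *
      (\<Sum>p\<in>spokes H x. z ^ card (core p - fan x ps)))"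
    unfolding sum_distrib_left
  proof (intro sum.cong refl)
    fix ps p assume "ps \<in> ?T n" and p: "p \<in> spokes H x"
    have "fan x (p # ps) = fan x ps \<union> (core p - fan x ps)" unfolding fan_def by auto
    also have "card \<dots> = card (fan x ps) + card (core p - fan x ps)"
      using fin \<open>ps \<in> ?T n\<close> finite_core[OF H p] by (intro card_Un_disjoint) auto
    finally show "z ^ card (fan x (p # ps)) = z ^ card (fan x ps) * z ^ card (core p - fan x ps)"
      by (simp add: power_add)
  qed
  also have "\<dots> \<le> (\<Sum>ps\<in>?T n. z ^ card (fan x ps) * F)"
  proof (intro sum_mono mult_left_mono)
    fix ps assume ps: "ps \<in> ?T n"
    have "length ps * k \<le> r * k" using ps Suc.prems by (intro mult_right_mono) auto
    then have "card (fan x ps) \<le> 1 + r * k" using card[of ps] ps by (auto intro: order_trans)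
    then show "(\<Sum>p\<in>spokes H x. z ^ card (core p - fan x ps)) \<le> F"
      using ps fin by (intro order_trans[OF sum_spokes_le[OF H k z] F]) (auto simp: fan_def)
  qed (use z in auto)
  also have "\<dots> = (\<Sum>ps\<in>?T n. z ^ card (fan x ps)) * F" by (simp add: sum_distrib_right)
  also have "\<dots> \<le> (z * F ^ n) * F"
    using Suc F0 by (intro mult_right_mono) auto
  finally show ?case by (simp add: mult_ac)
qed

section \<open>Breaker's combined strategy\<close>

text \<open>Of his \<open>q\<close> vertices Breaker uses \<open>b\<close> to hold the potential
  down and the rest to block all threats at Maker's new vertex. The potential bounds the
  \<open>r\<close>-th power of the number of threats, which leaves at most \<open>3 * F\<close> of
  them.\<close>

lemma breaker_wins_fan_criterion:
  fixes F :: real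
  assumes H: "uniform_hypergraph k H" and k: "k \<ge> 2" and r: "r > 0"
    and F: "real k * real (max_deg 1 H) * (1 / (1 + real b)) ^ (k - 2)
      + (\<Sum>l\<in>{2..k-1}. real (1 + r * k) ^ l *
          (real k * real (max_deg l H) * (1 / (1 + real b)) ^ (k - 1 - l))) \<le> F"
    and N: "real (card (verts H)) \<le> 3 ^ r"
    and q: "real b + 3 * F \<le> real q"
  shows "breaker_wins H q"
proof -
  define V where "V = verts H"
  define I where "I = (SIGMA x:V. {ps. set ps \<subseteq> spokes H x \<and> length ps = r})"
  define \<Phi> where "\<Phi> = potential b I (\<lambda>(x, ps). fan x ps)"
  define K where "K = real (card V) * F ^ r"
  have finV: "finite V" using H unfolding V_def uniform_hypergraph_def by simp
  have eV: "e \<subseteq> V" "card e = k" "finite e" if "e \<in> edges H" for e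
    using H that finite_subset unfolding V_def uniform_hypergraph_def by blast+
  have finI: "finite I"
    unfolding I_def using finV finite_spokes[OF H] finite_lists_length_eq by blast
  have finA: "finite (case i of (x, ps) \<Rightarrow> fan x ps)" if "i \<in> I" for i
    using that finite_core[OF H] unfolding I_def fan_def by (fastforce split: prod.splits)
  have F0: "F \<ge> 0"
    by (rule order_trans[OF _ F]) (auto intro!: add_nonneg_nonneg sum_nonneg)
  have init: "\<Phi> {x} {} \<le> K" for x
  proof -
    let ?z = "1 / (1 + real b)"
    have "\<Phi> {} {} = (\<Sum>x\<in>V. \<Sum>ps | set ps \<subseteq> spokes H x \<and> length ps = r. ?z ^ card (fan x ps))"
      unfolding \<Phi>_def potential_def I_def
      using finV finite_spokes[OF H] finite_lists_length_eq
      by (subst sum.Sigma) (auto intro!: sum.cong)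
    also have "\<dots> \<le> (\<Sum>x\<in>V. ?z * F ^ r)"
      using sum_fans_le[OF H k _ F order_refl] by (intro sum_mono) auto
    also have "\<dots> = ?z * K" unfolding K_def by simp
    finally have "(1 + real b) * \<Phi> {} {} \<le> K"
      by (simp add: field_simps)
    \<comment> \<open>Maker's first move raises each weight by a factor of at most
      \<open>1 + b\<close>; this cancels the factor \<open>?z\<close> that the common vertex
      contributes in \<open>sum_fans_le\<close>.\<close>
    moreover have "\<Phi> {x} {} \<le> (1 + real b) * \<Phi> {} {}"
    proof -
      have "\<Phi> {x} {} = \<Phi> {} {} + real b * (\<Sum>i\<in>I. if (case i of (x, ps) \<Rightarrow> fan x ps) \<inter> {} = {}
        \<and> x \<in> (case i of (x, ps) \<Rightarrow> fan x ps)
        then ?z ^ card ((case i of (x, ps) \<Rightarrow> fan x ps) - {}) else 0)"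
        unfolding \<Phi>_def using finA by (intro potential_insert_maker) auto
      also have "\<dots> \<le> \<Phi> {} {} + real b * \<Phi> {} {}"
        unfolding \<Phi>_def potential_def by (intro add_left_mono mult_left_mono sum_mono) auto
      finally show ?thesis by (simp add: algebra_simps)
    qed
    ultimately show ?thesis by linarith
  qed
  \<comment> \<open>The potential is measured after Maker's next move, the moment that
    \<open>breaker_response\<close> compares between rounds. Requiring two missing vertices in each
    live edge means that no single move completes one.\<close>
  define P where "P M B \<longleftrightarrow> M \<inter> B = {} \<and> (\<forall>x\<in>V - (M \<union> B). \<Phi> (insert x M) B \<le> K)
    \<and> (\<forall>e\<in>edges H. e \<inter> B = {} \<longrightarrow> card (e - M) \<ge> 2)" for M B
  show ?thesis
  proof (rule breaker_wins_invariantI[of P])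
    show "P {} {}" unfolding P_def using init eV k by auto
  next
    fix M B e
    assume "P M B" "verts H \<subseteq> M \<union> B" and e: "e \<in> edges H"
    show "\<not> e \<subseteq> M"
    proof
      assume "e \<subseteq> M"
      then have "card (e - M) = 0" "e \<inter> B = {}"
        using \<open>P M B\<close> unfolding P_def by (auto simp: Diff_eq_empty_iff[THEN iffD2])
      moreover have "e \<inter> B = {} \<longrightarrow> card (e - M) \<ge> 2"
        using \<open>P M B\<close> e unfolding P_def by blast
      ultimately show False by simp
    qed
  next
    fix M B x
    assume PMB: "P M B" and "x \<in> verts H - (M \<union> B)"
    then have x: "x \<in> V - (M \<union> B)" unfolding V_def by simp
    define M' where "M' = insert x M"
    define W where "W = V - (M' \<union> B)"
    have disj: "M' \<inter> B = {}" using PMB x unfolding P_def M'_def by auto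
    have \<Phi>K: "\<Phi> M' B \<le> K" using PMB x unfolding P_def M'_def by blast
    obtain Y1 where Y1: "Y1 \<subseteq> W" "card Y1 \<le> b"
      "\<And>y. y \<in> W - Y1 \<Longrightarrow> \<Phi> (insert y M') (B \<union> Y1) \<le> \<Phi> M' B"
      unfolding \<Phi>_def
      by (rule breaker_response[OF finI finA, of "\<lambda>i. i" W M' b B]) (auto simp: W_def finV)
    \<comment> \<open>\<open>Z\<close> also counts spokes whose last vertex is already occupied;
      only the free last vertices, collected in \<open>Y2\<close>, need an answer.\<close>
    define Z where "Z = {p \<in> spokes H x. core p \<subseteq> M'}"
    define Y2 where "Y2 = snd ` Z \<inter> W"
    have finZ: "finite Z" unfolding Z_def using finite_spokes[OF H] by simp
    \<comment> \<open>The ordered \<open>r\<close>-tuples from \<open>Z\<close>, repetitions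
      allowed, have fans owned by Maker, so each adds 1 to the potential. The bound
      \<open>3 ^ r\<close> on the number of vertices then disappears under the \<open>r\<close>-th
      root.\<close>
    have "real (card Z) ^ r = real (card (Pair x ` {ps. set ps \<subseteq> Z \<and> length ps = r}))"
      using card_lists_length_eq[OF finZ] by (simp add: card_image inj_on_def)
    also have "\<dots> \<le> \<Phi> M' B"
      unfolding \<Phi>_def
    proof (intro card_le_potential finI disj)
      show "Pair x ` {ps. set ps \<subseteq> Z \<and> length ps = r} \<subseteq> I"
        unfolding I_def Z_def using x by auto
      show "(case i of (x, ps) \<Rightarrow> fan x ps) \<subseteq> M'"
        if "i \<in> Pair x ` {ps. set ps \<subseteq> Z \<and> length ps = r}" for i
        using that unfolding fan_def Z_def M'_def by auto
    qed
    also have "\<dots> \<le> real (card V) * F ^ r" using \<Phi>K unfolding K_def .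
    also have "\<dots> \<le> 3 ^ r * F ^ r"
      using N F0 unfolding V_def by (intro mult_right_mono) auto
    also have "\<dots> = (3 * F) ^ r" by (simp add: power_mult_distrib)
    finally have "real (card Z) \<le> 3 * F"
      using r F0 power_mono_iff[of "real (card Z)" "3 * F" r] by simp
    moreover have "card Y2 \<le> card Z"
      unfolding Y2_def using finZ by (meson Int_lower1 card_image_le card_mono finite_imageI le_trans)
    ultimately have "real (card Y1 + card Y2) \<le> real q" using q Y1(2) by linarith
    then have cardY: "card (Y1 \<union> Y2) \<le> q" using card_Un_le[of Y1 Y2] by linarith
    have "P M' (B \<union> (Y1 \<union> Y2))"
      unfolding P_def
    proof (intro conjI ballI impI)
      show "M' \<inter> (B \<union> (Y1 \<union> Y2)) = {}"
        using disj Y1(1) unfolding Y2_def W_def by blast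
    next
      fix y assume y: "y \<in> V - (M' \<union> (B \<union> (Y1 \<union> Y2)))"
      have "\<Phi> (insert y M') (B \<union> (Y1 \<union> Y2)) \<le> \<Phi> (insert y M') (B \<union> Y1)"
        unfolding \<Phi>_def by (intro potential_antimono) auto
      also have "\<dots> \<le> \<Phi> M' B" using y unfolding W_def by (intro Y1(3)) (auto simp: W_def)
      finally show "\<Phi> (insert y M') (B \<union> (Y1 \<union> Y2)) \<le> K" using \<Phi>K by simp
    next
      fix e assume e: "e \<in> edges H" "e \<inter> (B \<union> (Y1 \<union> Y2)) = {}"
      have two: "card (e - M) \<ge> 2" using PMB e unfolding P_def by blast
      show "card (e - M') \<ge> 2"
      proof (cases "x \<in> e")
        case False
        then have "e - M' = e - M" unfolding M'_def by auto
        then show ?thesis using two by simp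
      next
        case True
        then have "e - M = insert x (e - M')" using x unfolding M'_def by auto
        then have "card (e - M) = Suc (card (e - M'))"
          using eV(3)[OF e(1)] unfolding M'_def by (metis Diff_iff card_insert_disjoint finite_Diff insertI1)
        \<comment> \<open>Only an edge through \<open>x\<close> can have lost a missing vertex; if a
          single \<open>v\<close> is left, then \<open>(e, v)\<close> is a threat and
          \<open>v\<close> was taken with \<open>Y2\<close>.\<close>
        moreover have "card (e - M') \<noteq> 1"
        proof
          assume "card (e - M') = 1"
          then obtain v where v: "e - M' = {v}" by (auto simp: card_1_singleton_iff)
          have "(e, v) \<in> Z"
            using v True e(1) unfolding Z_def spokes_def core_def M'_def by auto
          moreover have "v \<in> W"
            using v e eV(1)[OF e(1)] unfolding W_def by auto
          ultimately have "v \<in> Y2" unfolding Y2_def by force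
          then show False using v e(2) by blast
        qed
        ultimately show ?thesis using two by linarith
      qed
    qed
    moreover have "Y1 \<union> Y2 \<subseteq> verts H - (M \<union> B) - {x}"
      using Y1(1) unfolding Y2_def W_def M'_def V_def by auto
    ultimately show "\<exists>Y\<subseteq>verts H - (M \<union> B) - {x}. card Y \<le> q \<and> P (insert x M) (B \<union> Y)"
      using cardY unfolding M'_def by blast
  qed
qed

section \<open>Choice of the parameters for one hypergraph\<close>

lemma max_deg_1_pos:
  assumes H: "uniform_hypergraph k H" and k: "k \<ge> 1" and "edges H \<noteq> {}"
  shows "max_deg 1 H \<ge> 1"
proof -
  obtain e where e: "e \<in> edges H" using assms(3) by blast
  then have "card e = k" using H unfolding uniform_hypergraph_def by blast
  then obtain x where "x \<in> e" using k by fastforce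
  then have "{e \<in> edges H. {x} \<subseteq> e} \<noteq> {}" using e by blast
  moreover have "finite {e \<in> edges H. {x} \<subseteq> e}" using finite_edges[OF H] by simp
  ultimately have "deg H {x} \<ge> 1" unfolding deg_def by (simp add: Suc_le_eq card_gt_0_iff)
  then show ?thesis using deg_le_max_deg[OF H, of "{x}"] by simp
qed

text \<open>The case \<open>x = 0\<close> relies on \<open>0 powr a = 0\<close>; it occurs when a
  codegree vanishes.\<close>

lemma powr_inverse_power: "x \<ge> 0 \<Longrightarrow> n > 0 \<Longrightarrow> (x powr (1 / real n)) ^ n = x" for x :: real
  by (cases "x = 0") (simp_all add: powr_power)

text \<open>The theorem with explicit constants: \<open>large\<close> says that the fan size, of
  order \<open>ln N\<close>, loses against a small power of \<open>N\<close>. In the fan criterion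
  the term \<open>l = 1\<close> is then at most \<open>k * t\<close> and each other term at most
  \<open>t / k\<close>.\<close>

lemma threshold_bias_le_max_deg:
  fixes C \<epsilon> :: real
  defines "\<beta> \<equiv> \<lambda>k H. real (max_deg 1 H) powr (1 / (real k - 1))"
  assumes H: "uniform_hypergraph k H" and k: "k \<ge> 2" and ne: "edges H \<noteq> {}"
    and N: "card (verts H) \<ge> 2" and C: "C \<ge> 1" and \<epsilon>: "\<epsilon> > 0"
    and \<Delta>: "\<And>l. l \<in> {2..k-1} \<Longrightarrow> real (max_deg l H) powr (1 / (real k - real l))
       * real (card (verts H)) powr \<epsilon> \<le> C * \<beta> k H"
    and large: "real k * C * (1 + real k * (ln (real (card (verts H))) + 1))
       \<le> real (card (verts H)) powr (\<epsilon> / real k)"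
  shows "real (threshold_bias H) \<le> (3 * real k + 6) * \<beta> k H"
proof -
  define t where "t = \<beta> k H"
  define n where "n = real (card (verts H))"
  \<comment> \<open>Rounding up gives \<open>z \<le> 1 / t\<close> and
    \<open>n \<le> exp r \<le> 3 ^ r\<close>, as the fan criterion requires.\<close>
  define b where "b = nat \<lceil>t\<rceil>"
  define r where "r = nat \<lceil>ln n\<rceil>"
  define m where "m = real (1 + r * k)"
  define X where "X = n powr \<epsilon>"
  define z where "z = 1 / (1 + real b)"
  have n2: "n \<ge> 2" using N unfolding n_def by linarith
  have lnn: "ln n > 0" using n2 by simp
  have r: "r > 0" "ln n \<le> real r" "real r \<le> ln n + 1"
    using lnn unfolding r_def by linarith+
  have D1: "real (max_deg 1 H) \<ge> 1" using max_deg_1_pos[OF H] k ne by force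
  have t1: "t \<ge> 1" unfolding t_def \<beta>_def using D1 k by (intro ge_one_powr_ge_zero) auto
  have D: "real (max_deg 1 H) = t ^ (k - 1)"
  proof -
    have "real k - 1 = real (k - 1)" "k - 1 > 0" using k by auto
    then show ?thesis unfolding t_def \<beta>_def by (simp only: powr_inverse_power of_nat_0_le_iff)
  qed
  have b: "t \<le> real b" "real b \<le> t + 1" using t1 unfolding b_def by linarith+
  have z: "z \<ge> 0" "z \<le> 1 / t"
    unfolding z_def using b t1 by (auto intro!: divide_left_mono)
  have X1: "X \<ge> 1" unfolding X_def using n2 \<epsilon> by (intro ge_one_powr_ge_zero) auto
  have m1: "m \<ge> 1" unfolding m_def by simp
  \<comment> \<open>The \<open>k\<close>-th power of the right side of \<open>large\<close> is
    \<open>X\<close>; on the left it covers the factors \<open>m ^ l\<close>,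
    \<open>C ^ (k - l)\<close> and \<open>k ^ 2\<close> at once.\<close>
  have m: "(real k * C * m) ^ k \<le> X"
  proof -
    have "m \<le> 1 + real k * (ln n + 1)"
      unfolding m_def using r(3) by (simp add: mult.commute mult_left_mono)
    then have "real k * C * m \<le> real k * C * (1 + real k * (ln n + 1))"
      using C by (intro mult_left_mono) auto
    also have "\<dots> \<le> n powr (\<epsilon> / real k)" using large unfolding n_def .
    finally have "(real k * C * m) ^ k \<le> (n powr (\<epsilon> / real k)) ^ k"
      using C m1 by (intro power_mono) auto
    also have "\<dots> = X" unfolding X_def using k n2 by (simp add: powr_power)
    finally show ?thesis .
  qed
  have first: "real k * real (max_deg 1 H) * z ^ (k - 2) \<le> real k * t"
  proof -
    have "real (max_deg 1 H) * z ^ (k - 2) \<le> t ^ (k - 1) * (1 / t) ^ (k - 2)"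
      unfolding D using z t1 by (intro mult_left_mono power_mono) auto
    also have "t ^ (k - 1) = t * t ^ (k - 2)"
      using k by (metis Suc_1 Suc_diff_Suc Suc_le_lessD power_Suc)
    also have "t * t ^ (k - 2) * (1 / t) ^ (k - 2) = t"
      using t1 by (simp add: power_one_over)
    finally show ?thesis by (simp add: mult.assoc mult_left_mono)
  qed
  \<comment> \<open>The codegree is at most \<open>(C * t / X) ^ (k - l)\<close>, and
    \<open>z ^ (k - 1 - l)\<close> cancels all but one factor \<open>t\<close>. Of the
    \<open>k - l \<ge> 1\<close> factors \<open>1 / X\<close> a single one suffices.\<close>
  have other: "m ^ l * (real k * real (max_deg l H) * z ^ (k - 1 - l)) \<le> t / real k"
    if l: "l \<in> {2..k-1}" for l
  proof -
    define d where "d = real (max_deg l H) powr (1 / (real k - real l))"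
    define j where "j = k - 1 - l"
    have kl: "k - l = Suc j" using l unfolding j_def by auto
    have "d ^ (k - l) = real (max_deg l H)"
    proof -
      have "real k - real l = real (k - l)" "k - l > 0" using l by auto
      then show ?thesis unfolding d_def by (simp only: powr_inverse_power of_nat_0_le_iff)
    qed
    moreover have "d \<le> C * t / X"
      using \<Delta>[OF l, folded n_def, folded X_def t_def d_def] X1 by (subst pos_le_divide_eq) auto
    ultimately have "real (max_deg l H) \<le> (C * t / X) ^ (Suc j)"
      unfolding kl by (metis d_def power_mono powr_ge_zero)
    then have "real (max_deg l H) * z ^ j \<le> (C * t / X) ^ (Suc j) * (1 / t) ^ j"
      using z t1 C X1 by (intro mult_mono power_mono) auto
    also have "\<dots> = C ^ Suc j * t * (1 / X) ^ Suc j"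
      using t1 by (simp add: power_divide power_mult_distrib field_simps)
    also have "\<dots> \<le> C ^ k * t * (1 / X) ^ 1"
      using C t1 X1 l unfolding j_def
      by (intro mult_mono power_increasing power_decreasing) auto
    finally have le: "real (max_deg l H) * z ^ j \<le> C ^ k * t / X" by simp
    have "m ^ l * (real k * real (max_deg l H) * z ^ j) \<le> m ^ k * (real k * (C ^ k * t / X))"
      unfolding mult.assoc using le m1 l z(1)
      by (intro mult_mono power_increasing) auto
    also have "\<dots> \<le> t / real k"
    proof -
      \<comment> \<open>One factor \<open>k\<close> comes from the spoke count, the other makes the
        bound \<open>t / k\<close>, so that the fewer than \<open>k\<close> terms sum to at most
        \<open>t\<close>.\<close>
      have "real k * real k * (C * m) ^ k \<le> real k ^ k * (C * m) ^ k"
        using power_increasing[of 2 k "real k"] k C m1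
        by (intro mult_right_mono) (auto simp: power2_eq_square)
      also have "\<dots> = (real k * C * m) ^ k" by (simp add: power_mult_distrib mult.assoc)
      also note m
      finally have "real k * real k * (C * m) ^ k * t \<le> X * t"
        using t1 by (intro mult_right_mono) auto
      then show ?thesis using X1 k by (simp add: field_simps power_mult_distrib)
    qed
    finally show ?thesis unfolding j_def .
  qed
  define F where "F = (real k + 1) * t"
  define q where "q = nat \<lceil>real b + 3 * F\<rceil>"
  have "real k * real (max_deg 1 H) * z ^ (k - 2)
      + (\<Sum>l\<in>{2..k-1}. m ^ l * (real k * real (max_deg l H) * z ^ (k - 1 - l)))
    \<le> real k * t + (\<Sum>l\<in>{2..k-1}. t / real k)"
    by (intro add_mono sum_mono first other)
  also have "\<dots> \<le> real k * t + real k * (t / real k)"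
    using t1 by (simp only: sum_constant) (intro add_left_mono mult_right_mono, auto)
  also have "\<dots> = F" unfolding F_def using k by (simp add: algebra_simps)
  finally have F: "real k * real (max_deg 1 H) * z ^ (k - 2)
      + (\<Sum>l\<in>{2..k-1}. m ^ l * (real k * real (max_deg l H) * z ^ (k - 1 - l))) \<le> F" .
  have "n = exp (ln n)" using n2 by simp
  also have "\<dots> \<le> exp (real r)" using r(2) by simp
  also have "\<dots> = exp 1 ^ r" by (simp add: exp_of_nat_mult[symmetric])
  also have "\<dots> \<le> 3 ^ r" using exp_le by (intro power_mono) auto
  finally have "n \<le> 3 ^ r" .
  moreover have F0: "F \<ge> 0" unfolding F_def using t1 by simp
  moreover have q: "real b + 3 * F \<le> real q" "real q \<le> real b + 3 * F + 1"
    unfolding q_def using F0 by linarith+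
  ultimately have "breaker_wins H q"
    using breaker_wins_fan_criterion[OF H k r(1), of b F q] F unfolding z_def m_def n_def by blast
  moreover have "0 < q" using q(1) b(1) t1 F0 by linarith
  ultimately have "threshold_bias H \<le> q"
    unfolding threshold_bias_def by (intro Least_le) simp
  then have "real (threshold_bias H) \<le> real b + 3 * F + 1" using q(2) by linarith
  \<comment> \<open>The total is at most \<open>(3 * k + 4) * t + 2\<close>; the rounding errors are
    absorbed by \<open>t \<ge> 1\<close>, which holds since there is an edge.\<close>
  also have "\<dots> \<le> (3 * real k + 6) * t" using b(2) t1 unfolding F_def by (simp add: algebra_simps)
  finally show ?thesis unfolding t_def .
qed

section \<open>Asymptotics along the sequence\<close>

text \<open>Split the power into two equal halves: one dominates \<open>1\<close> and, up to a
  constant, \<open>ln x\<close>; the other eventually exceeds the constants in front.\<close>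

lemma eventually_affine_ln_le_powr:
  fixes a c \<delta> :: real
  assumes "\<delta> > 0"
  shows "\<forall>\<^sub>F x in at_top. a + c * ln x \<le> x powr \<delta>"
proof -
  let ?d = "\<delta> / 2"
  let ?K = "\<bar>a\<bar> + \<bar>c\<bar> / ?d"
  show ?thesis
    using eventually_ge_at_top[of 1] eventually_ge_at_top[of "?K powr (1 / ?d)"]
  proof eventually_elim
    case (elim x)
    have "?K \<ge> 0" using assms by simp
    then have "?K = (?K powr (1 / ?d)) powr ?d" using assms by (simp add: powr_powr)
    also have "\<dots> \<le> x powr ?d" using elim assms by (intro powr_mono2) auto
    finally have K: "?K \<le> x powr ?d" .
    have y1: "x powr ?d \<ge> 1" using elim assms by (intro ge_one_powr_ge_zero) auto
    have "c * ln x \<le> \<bar>c\<bar> * (x powr ?d / ?d)"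
      using elim assms ln_powr_bound[of x ?d] by (intro mult_mono) auto
    moreover have "a \<le> \<bar>a\<bar> * x powr ?d"
      using y1 mult_left_mono[of 1 "x powr ?d" "\<bar>a\<bar>"] by simp
    ultimately have "a + c * ln x \<le> (\<bar>a\<bar> + \<bar>c\<bar> / ?d) * x powr ?d"
      by (simp add: algebra_simps)
    also have "\<dots> \<le> x powr ?d * x powr ?d"
      using K by (intro mult_right_mono) auto
    also have "\<dots> = x powr \<delta>" by (simp add: powr_add[symmetric])
    finally show ?case .
  qed
qed

theorem theorem1p3:
  fixes k :: nat and H :: "nat \<Rightarrow> 'a hypergraph"
  assumes "k \<ge> 2"
    and "\<And>n. uniform_hypergraph k (H n)"
    and "\<forall>\<^sub>F n in sequentially. edges (H n) \<noteq> {}"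
    and "filterlim (\<lambda>n. card (verts (H n))) at_top sequentially"
    and "\<exists>\<epsilon>>0. \<forall>l\<in>{2..k-1}.
           (\<lambda>n. real (max_deg l (H n)) powr (1 / (real k - real l))
                  * real (card (verts (H n))) powr \<epsilon>)
             \<in> O(\<lambda>n. real (max_deg 1 (H n)) powr (1 / (real k - 1)))"
  shows "(\<lambda>n. real (threshold_bias (H n)))
           \<in> O(\<lambda>n. real (max_deg 1 (H n)) powr (1 / (real k - 1)))"
proof -
  let ?N = "\<lambda>n. real (card (verts (H n)))"
  let ?\<beta> = "\<lambda>n. real (max_deg 1 (H n)) powr (1 / (real k - 1))"
  let ?f = "\<lambda>\<epsilon> l n. real (max_deg l (H n)) powr (1 / (real k - real l)) * ?N n powr \<epsilon>"
  obtain \<epsilon> where \<epsilon>: "\<epsilon> > 0" and O: "\<And>l. l \<in> {2..k-1} \<Longrightarrow> ?f \<epsilon> l \<in> O(?\<beta>)"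
    using assms(5) by blast
  have "\<forall>l\<in>{2..k-1}. \<exists>c>0. \<forall>\<^sub>F n in sequentially. ?f \<epsilon> l n \<le> c * ?\<beta> n"
  proof
    fix l assume "l \<in> {2..k-1}"
    from O[OF this] show "\<exists>c>0. \<forall>\<^sub>F n in sequentially. ?f \<epsilon> l n \<le> c * ?\<beta> n"
      by (elim landau_o.bigE) auto
  qed
  then obtain c where c: "\<And>l. l \<in> {2..k-1} \<Longrightarrow> c l > 0"
    "\<And>l. l \<in> {2..k-1} \<Longrightarrow> \<forall>\<^sub>F n in sequentially. ?f \<epsilon> l n \<le> c l * ?\<beta> n"
    using bchoice[of "{2..k-1}" "\<lambda>l c. c > 0 \<and> (\<forall>\<^sub>F n in sequentially. ?f \<epsilon> l n \<le> c * ?\<beta> n)"]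
    by blast
  \<comment> \<open>A single constant for the finitely many \<open>l\<close>; the summand 1 ensures
    \<open>C \<ge> 1\<close> even when \<open>k = 2\<close> and the range is empty.\<close>
  define C where "C = 1 + (\<Sum>l\<in>{2..k-1}. c l)"
  have C1: "C \<ge> 1" unfolding C_def using sum_nonneg[of "{2..k-1}" c] less_imp_le[OF c(1)] by force
  have cC: "c l \<le> C" if "l \<in> {2..k-1}" for l
    using member_le_sum[OF that, of c] less_imp_le[OF c(1)] unfolding C_def by fastforce
  have ev1: "\<forall>\<^sub>F n in sequentially. \<forall>l\<in>{2..k-1}. ?f \<epsilon> l n \<le> C * ?\<beta> n"
  proof (rule eventually_ball_finite)
    show "\<forall>l\<in>{2..k-1}. \<forall>\<^sub>F n in sequentially. ?f \<epsilon> l n \<le> C * ?\<beta> n"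
    proof
      fix l assume l: "l \<in> {2..k-1}"
      show "\<forall>\<^sub>F n in sequentially. ?f \<epsilon> l n \<le> C * ?\<beta> n"
        using c(2)[OF l] by eventually_elim (meson cC[OF l] mult_right_mono order_trans powr_ge_zero)
    qed
  qed simp
  have lim: "filterlim ?N at_top sequentially"
    using filterlim_compose[OF filterlim_real_sequentially assms(4)] .
  have "\<epsilon> / real k > 0" using \<epsilon> assms(1) by simp
  from eventually_compose_filterlim[OF eventually_affine_ln_le_powr[OF this] lim]
  \<comment> \<open>This is the condition \<open>large\<close> multiplied out as an affine function
    of the logarithm.\<close>
  have ev2: "\<forall>\<^sub>F n in sequentially. real k * C * (1 + real k) + real k * C * real k * ln (?N n)
      \<le> ?N n powr (\<epsilon> / real k)" .
  have ev3: "\<forall>\<^sub>F n in sequentially. card (verts (H n)) \<ge> 2"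
    using assms(4) unfolding filterlim_at_top by blast
  have "\<forall>\<^sub>F n in sequentially. real (threshold_bias (H n)) \<le> (3 * real k + 6) * ?\<beta> n"
    using ev1 ev2 ev3 assms(3)
  proof eventually_elim
    case (elim n)
    show ?case
      using elim by (intro threshold_bias_le_max_deg[OF assms(2,1) _ _ C1 \<epsilon>])
        (auto simp: algebra_simps)
  qed
  then show ?thesis by (intro bigoI[where c = "3 * real k + 6"]) auto
qed

end
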